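(* In the polynomial ring $\mathbb{R}[X,Y]$ let $f_1=Y^3$, $f_2=Y+X$, $f_3=1-XY$, $f_4=1-X^2$. Then the preordering $P=\mathrm{PO}(f_1,f_2,f_3,f_4)$ has the strong moment property (SMP), i.e. $P^{\vee\vee}=\mathrm{Pos}(\mathcal{S}(P))$.
   Context: For $f_1,\ldots,f_s\in\mathbb{R}[X,Y]$, $\mathrm{PO}(f_1,\ldots,f_s)=\{\sum_{e\in\{0,1\}^s}\sigma_e f_1^{e_1}\cdots f_s^{e_s}\mid \sigma_e \text{ a sum of squares in } \mathbb{R}[X,Y]\}$ is the preordering generated by $f_1,\ldots,f_s$. For $P=\mathrm{PO}(f_1,\ldots,f_s)$, $\mathcal{S}(P)=\{x\in\mathbb{R}^2\mid f_1(x)\ge 0,\ldots,f_s(x)\ge 0\}$, and for a set $Z\subseteq\mathbb{R}^2$, $\mathrm{Pos}(Z)$ is the set of polynomials in $\mathbb{R}[X,Y]$ that are nonnegative on $Z$. The double dual cone is $P^{\vee\vee}=\{f\in\mathbb{R}[X,Y]\mid L(f)\ge 0 \text{ for all linear } L\colon\mathbb{R}[X,Y]\to\mathbb{R} \text{ with } L(P)\subseteq\mathbb{R}_{\ge 0}\}$. *)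

theory Defs
  imports "HOL-Analysis.Analysis" "HOL-Computational_Algebra.Polynomial"
begin

(* The ring R[X,Y] is represented as R[X][Y]: the outer variable is Y and the
   coefficients are polynomials in X. *)

type_synonym rpoly2 = "real poly poly"

definition var_X :: rpoly2 where
  "var_X = [:[:0, 1:]:]"

definition var_Y :: rpoly2 where
  "var_Y = [:0, 1:]"

definition scale2 :: "real \<Rightarrow> rpoly2 \<Rightarrow> rpoly2" where
  "scale2 c f = smult [:c:] f"

definition eval2 :: "rpoly2 \<Rightarrow> real \<times> real \<Rightarrow> real" where
  "eval2 f z = poly (poly f [:snd z:]) (fst z)"

lemma eval2_simps [simp]:
  "eval2 var_X (x, y) = x"
  "eval2 var_Y (x, y) = y"
  "eval2 0 z = 0"
  "eval2 1 z = 1"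
  "eval2 (f + g) z = eval2 f z + eval2 g z"
  "eval2 (f - g) z = eval2 f z - eval2 g z"
  "eval2 (f * g) z = eval2 f z * eval2 g z"
  "eval2 (f ^ n) z = eval2 f z ^ n"
  "eval2 (scale2 c f) z = c * eval2 f z"
  by (simp_all add: eval2_def var_X_def var_Y_def scale2_def)

definition sos :: "rpoly2 set" where
  "sos = {\<Sum>q\<leftarrow>qs. q ^ 2 | qs. True}"

definition preordering :: "rpoly2 list \<Rightarrow> rpoly2 set" where
  "preordering fs =
     {\<Sum>e \<in> {..<length fs} \<rightarrow>\<^sub>E {0, 1::nat}. \<sigma> e * (\<Prod>i<length fs. (fs ! i) ^ e i) | \<sigma>.
        \<forall>e \<in> {..<length fs} \<rightarrow>\<^sub>E {0, 1}. \<sigma> e \<in> sos}"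

(* S(P) for P = PO(fs).  Since every generator lies in P, and P is nonnegative wherever all
   generators are, this set depends only on the preordering and not on the generators chosen. *)

definition semialg_set :: "rpoly2 list \<Rightarrow> (real \<times> real) set" where
  "semialg_set fs = {z. \<forall>f \<in> set fs. eval2 f z \<ge> 0}"

definition Pos :: "(real \<times> real) set \<Rightarrow> rpoly2 set" where
  "Pos Z = {f. \<forall>z \<in> Z. eval2 f z \<ge> 0}"

abbreviation linear_functional :: "(rpoly2 \<Rightarrow> real) \<Rightarrow> bool" where
  "linear_functional L \<equiv> Vector_Spaces.linear scale2 (*) L"

(* The library predicate includes the vector space axioms for both scalings; they hold here, so
   only additivity and homogeneity remain. *)

lemma linear_functional_iff:
  "linear_functional L \<longleftrightarrow>
     (\<forall>f g. L (f + g) = L f + L g) \<and> (\<forall>c f. L (scale2 c f) = c * L f)"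
proof -
  have "vector_space scale2"
    by unfold_locales
      (simp_all add: scale2_def smult_add_right smult_add_left [symmetric] mult.commute flip: one_pCons)
  moreover have "vector_space ((*) :: real \<Rightarrow> real \<Rightarrow> real)"
    by unfold_locales (simp_all add: algebra_simps)
  ultimately show ?thesis
    by (simp add: Vector_Spaces.linear_iff)
qed

definition double_dual :: "rpoly2 set \<Rightarrow> rpoly2 set" where
  "double_dual P = {f. \<forall>L. linear_functional L \<and> L ` P \<subseteq> {0..} \<longrightarrow> L f \<ge> 0}"

definition strong_moment_property :: "rpoly2 list \<Rightarrow> bool" where
  "strong_moment_property fs \<longleftrightarrow> double_dual (preordering fs) = Pos (semialg_set fs)"

end

theory Submission
  imports Defs "HOL-Computational_Algebra.Fundamental_Theorem_Algebra"
begin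

text \<open>
  The double dual of a preordering is again a preordering, and it contains \<open>f\<close> as soon as, for
  some fixed \<open>q\<close>, it contains \<open>f + e q\<close> for all \<open>e > 0\<close> (\<open>double_dual_mult\<close>, \<open>double_dual_limit\<close>). Writing \<open>Q\<close> for it, the theorem
  asks that every polynomial nonnegative on the set lie in \<open>Q\<close>; the opposite inclusion is tested by
  point evaluations.

  Since \<open>1 - X\<^sup>2\<close> is a generator, \<open>X\<close> is a bounded function on the set, and membership in \<open>Q\<close> can be checked
  on the fibres \<open>X = x\<close> with \<open>-1 \<le> x \<le> 1\<close>. This is an elementary case of the fibre theorem for the moment
  problem. Suppose that over each \<open>x\<close> the restriction of \<open>f\<close> extends to a member of \<open>Q\<close> of bounded degree
  in \<open>Y\<close>. Polynomial weights in \<open>X\<close>, nonnegative on the base interval, patch these extensions into a member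
  of \<open>Q\<close> whose difference from \<open>f\<close> has small coefficients. A remainder of that kind is absorbed by a small
  multiple of a fixed polynomial (\<open>small_coefficients\<close>, \<open>fibrewise_mem\<close>).

  On a single fibre the problem has one variable: factoring over the reals, a polynomial nonnegative on
  an interval is a product of squares, sums of two squares and linear forms positive on that interval
  (\<open>interval_certificate\<close>). Only these linear forms have to be extended to the plane. For \<open>x \<le> 0\<close> the
  generator \<open>Y + X\<close> does this. For \<open>x > 0\<close> the forms needed are \<open>Y\<close> and \<open>1 - X Y\<close>, whereas the
  generators offer \<open>Y\<^sup>3\<close> instead of \<open>Y\<close>. The heart of the matter is therefore that \<open>Y\<close> belongs to \<open>Q\<close>
  (\<open>var_Y_mem\<close>). For fixed \<open>e > 0\<close> the same fibrewise argument shows \<open>Y + e \<in> Q\<close>: over \<open>x \<le> e\<close> because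
  \<open>Y + X\<close> is a generator, and over \<open>x > e\<close> because there is a polynomial \<open>k\<close> in \<open>Y\<close> such that \<open>Y + e - Y\<^sup>3 k\<^sup>2\<close> is
  nonnegative for \<open>Y < 1 / e\<close> (\<open>damping_polynomial\<close>), which \<open>1 - X Y\<close> turns into a certificate.
\<close>

section \<open>Polynomials nonnegative on an interval\<close>

lemma map_poly_complex_of_real_add:
  "map_poly complex_of_real (p + q) = map_poly of_real p + map_poly of_real q"
  by (rule poly_eqI) (simp add: coeff_map_poly)

lemma map_poly_complex_of_real_smult:
  "map_poly complex_of_real (smult c p) = smult (of_real c) (map_poly of_real p)"
  by (rule poly_eqI) (simp add: coeff_map_poly)

lemma map_poly_complex_of_real_mult:
  "map_poly complex_of_real (p * q) = map_poly of_real p * map_poly of_real q"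
  by (induction p)
    (simp_all add: map_poly_pCons map_poly_complex_of_real_add map_poly_complex_of_real_smult)

text \<open>The quadratic is the minimal polynomial of \<open>z\<close> over the reals, so the remainder of \<open>p\<close>, a linear
real polynomial vanishing at a non-real number, is zero.\<close>

lemma dvd_real_quadratic_of_complex_root:
  fixes p :: "real poly"
  assumes root: "poly (map_poly complex_of_real p) z = 0" and "Im z \<noteq> 0"
  shows "[:- Re z, 1:]\<^sup>2 + [:(Im z)\<^sup>2:] dvd p"
proof -
  define m where "m = [:- Re z, 1:]\<^sup>2 + [:(Im z)\<^sup>2:]"
  have m: "m = [:(Re z)\<^sup>2 + (Im z)\<^sup>2, - 2 * Re z, 1:]"
    by (simp add: m_def power2_eq_square)
  then have "m \<noteq> 0" and deg: "degree m = 2"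
    by simp_all
  define r where "r = p mod m"
  have "degree r < 2" if "r \<noteq> 0"
    using degree_mod_less[OF \<open>m \<noteq> 0\<close>, of p] that deg by (simp add: r_def)
  then have "degree r \<le> 1"
    by (cases "r = 0") auto
  then have r: "r = [:coeff r 0, coeff r 1:]"
    by (intro poly_eqI) (auto simp: coeff_pCons coeff_eq_0 split: nat.splits)
  have "poly (map_poly complex_of_real m) z = 0"
    by (simp add: m map_poly_pCons complex_eq_iff power2_eq_square algebra_simps)
  moreover have "p = m * (p div m) + r"
    by (simp add: r_def)
  then have "poly (map_poly complex_of_real p) z =
      poly (map_poly of_real m) z * poly (map_poly of_real (p div m)) z + poly (map_poly of_real r) z"
    by (metis map_poly_complex_of_real_add map_poly_complex_of_real_mult poly_add poly_mult)
  ultimately have "poly (map_poly complex_of_real r) z = 0"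
    using root by simp
  then have "of_real (coeff r 0) + z * of_real (coeff r 1) = 0"
    by (subst (asm) r) (simp add: map_poly_pCons)
  then have "coeff r 0 = 0" "coeff r 1 = 0"
    using \<open>Im z \<noteq> 0\<close> by (auto simp: complex_eq_iff)
  then have "r = 0"
    using r by simp
  then show ?thesis
    by (auto simp: r_def m_def mod_eq_0_iff_dvd)
qed

lemma poly_nonneg_at_limit:
  fixes p :: "real poly"
  assumes "\<forall>\<^sub>F x in F. poly p x \<ge> 0" "F \<noteq> bot" "F \<le> nhds c"
  shows "poly p c \<ge> 0"
proof (rule tendsto_lowerbound[OF _ assms(1,2)])
  have "(poly p \<longlongrightarrow> poly p c) (nhds c)"
    by (simp add: tendsto_nhds_iff flip: isCont_def)
  then show "(poly p \<longlongrightarrow> poly p c) F"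
    using assms(3) tendsto_mono by blast
qed

text \<open>Up to a nonnegative constant, a polynomial nonnegative on an open interval is a product of
factors of three kinds: irreducible quadratics, squares of linear forms belonging to interior roots, and linear forms of constant sign
belonging to the other roots. This covers the certificates on the line, on half-lines and on bounded
intervals at once. The grading of the family \<open>Q\<close> records that the certificate needs no degree above
that of the polynomial; such a uniform bound is what allows certificates on infinitely many fibres
to be patched together.\<close>

lemma interval_certificate:
  fixes p :: "real poly" and I :: "real set" and Q :: "nat \<Rightarrow> real poly set"
  assumes const: "\<And>c. c \<ge> 0 \<Longrightarrow> [:c:] \<in> Q 0"
    and quad: "\<And>a b. [:-a, 1:]\<^sup>2 + [:b\<^sup>2:] \<in> Q 2"
    and lower: "\<And>c. (\<And>y. y \<in> I \<Longrightarrow> c < y) \<Longrightarrow> [:-c, 1:] \<in> Q 1"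
    and upper: "\<And>c. (\<And>y. y \<in> I \<Longrightarrow> y < c) \<Longrightarrow> [:c, -1:] \<in> Q 1"
    and mult: "\<And>p q m n. p \<in> Q m \<Longrightarrow> q \<in> Q n \<Longrightarrow> p * q \<in> Q (m + n)"
    and I: "open I" "connected I" "I \<noteq> {}"
    and nonneg: "\<And>y. y \<in> I \<Longrightarrow> poly p y \<ge> 0"
  shows "p \<in> Q (degree p)"
  using nonneg
proof (induction "degree p" arbitrary: p rule: less_induct)
  case less
  \<comment> \<open>The induction works on the complementary factor; its degree is additive, as the grading requires.\<close>
  have step: "p \<in> Q (degree p)"
    if "p = f * q" "f \<in> Q k" "degree f = k" "k > 0" "p \<noteq> 0" "\<And>y. y \<in> I \<Longrightarrow> poly q y \<ge> 0" for f q k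
  proof -
    have "degree p = k + degree q"
      using that by (simp add: degree_mult_eq)
    moreover have "q \<in> Q (degree q)"
      using less.hyps[of q] that calculation by simp
    ultimately show ?thesis
      using mult[OF that(2)] that(1) by simp
  qed
  show ?case
  proof (cases "degree p = 0")
    case True
    then obtain c where "p = [:c:]"
      by (meson degree_eq_zeroE)
    then show ?thesis
      using less.prems I(3) const by fastforce
  next
    case False
    then have "p \<noteq> 0"
      by auto
    have "\<not> constant (poly (map_poly complex_of_real p))"
      using False by (simp add: constant_degree degree_map_poly)
    then obtain z where z: "poly (map_poly complex_of_real p) z = 0"
      using fundamental_theorem_of_algebra by blast
    show ?thesis
    proof (cases "Im z = 0")
      case False
      then obtain q where q: "p = ([:- Re z, 1:]\<^sup>2 + [:(Im z)\<^sup>2:]) * q"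
        using dvd_real_quadratic_of_complex_root[OF z] by (meson dvdE)
      have "poly q y \<ge> 0" if "y \<in> I" for y
      proof -
        have "(y - Re z)\<^sup>2 + (Im z)\<^sup>2 > 0"
          using False by (simp add: add_nonneg_pos)
        moreover have "((y - Re z)\<^sup>2 + (Im z)\<^sup>2) * poly q y \<ge> 0"
          using less.prems[OF that] by (simp add: q)
        ultimately show ?thesis
          by (simp add: zero_le_mult_iff)
      qed
      then show ?thesis
        by (intro step[OF q quad]) (auto simp: \<open>p \<noteq> 0\<close> power2_eq_square)
    next
      case True
      define c where "c = Re z"
      have "of_real (poly p c) = poly (map_poly complex_of_real p) z"
        using True by (simp add: c_def poly_altdef degree_map_poly coeff_map_poly complex_is_Real_iff)
      then have "poly p c = 0"
        using z by simp
      then obtain q where q: "p = [:-c, 1:] * q"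
        using poly_eq_0_iff_dvd by (metis dvdE)
      have sgn: "(y - c) * poly q y \<ge> 0" if "y \<in> I" for y
        using less.prems[OF that] by (simp add: q algebra_simps)
      show ?thesis
      proof (cases "c \<in> I")
        case False
        then have "(\<forall>y\<in>I. c < y) \<or> (\<forall>y\<in>I. y < c)"
          using I(2) unfolding connected_iff_interval by (meson less_eq_real_def linorder_not_le)
        then show ?thesis
        proof
          assume c: "\<forall>y\<in>I. c < y"
          then have "poly q y \<ge> 0" if "y \<in> I" for y
            using sgn[OF that] that by (fastforce simp: zero_le_mult_iff)
          then show ?thesis
            using c by (intro step[OF q lower]) (auto simp: \<open>p \<noteq> 0\<close>)
        next
          assume c: "\<forall>y\<in>I. y < c"
          then have "poly (- q) y \<ge> 0" if "y \<in> I" for y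
            using sgn[OF that] that by (fastforce simp: zero_le_mult_iff)
          moreover have neg: "p = [:c, -1:] * (- q)"
            by (simp add: q)
          ultimately show ?thesis
            using c by (intro step[OF neg upper]) (auto simp: \<open>p \<noteq> 0\<close>)
        qed
      next
        case True
        then have ev: "\<forall>\<^sub>F y in nhds c. y \<in> I"
          using I(1) by (simp add: eventually_nhds_in_open)
        have left: "\<forall>\<^sub>F y in at_left c. y < c"
          by (simp add: eventually_at_filter)
        \<comment> \<open>The cofactor changes sign at an interior root, so the root is at least double.\<close>
        have "poly q c \<ge> 0"
        proof (rule poly_nonneg_at_limit)
          show "\<forall>\<^sub>F y in at_right c. poly q y \<ge> 0"
            using filter_leD[OF at_within_le_nhds ev, of "{c<..}"]
              eventually_at_right_less[of c]
            by eventually_elim (use sgn in \<open>fastforce simp: zero_le_mult_iff\<close>)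
        qed (simp_all add: at_within_le_nhds)
        moreover have "poly (- q) c \<ge> 0"
        proof (rule poly_nonneg_at_limit)
          show "\<forall>\<^sub>F y in at_left c. poly (- q) y \<ge> 0"
            using filter_leD[OF at_within_le_nhds ev, of "{..<c}"] left
            by eventually_elim (use sgn in \<open>fastforce simp: zero_le_mult_iff\<close>)
        qed (simp_all add: at_within_le_nhds)
        ultimately have "poly q c = 0"
          by simp
        then obtain r where r: "q = [:-c, 1:] * r"
          using poly_eq_0_iff_dvd by (metis dvdE)
        have p: "p = ([:- c, 1:]\<^sup>2 + [:0\<^sup>2:]) * r"
          unfolding q r
          by (simp add: power2_eq_square mult.assoc del: mult_pCons_left mult_pCons_right)
        have r_nonneg: "poly r y \<ge> 0" if "y \<in> I" "y \<noteq> c" for y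
        proof -
          have "(y - c)\<^sup>2 * poly r y \<ge> 0"
            using less.prems[OF that(1)] by (simp add: p power2_eq_square algebra_simps)
          then show ?thesis
            using that by (simp add: zero_le_mult_iff)
        qed
        moreover have "poly r c \<ge> 0"
        proof (rule poly_nonneg_at_limit)
          show "\<forall>\<^sub>F y in at c. poly r y \<ge> 0"
            using filter_leD[OF at_within_le_nhds ev, of UNIV] eventually_neq_at_within[of c]
            by eventually_elim (rule r_nonneg)
        qed (simp_all add: at_within_le_nhds)
        ultimately show ?thesis
          by (intro step[OF p quad]) (auto simp: \<open>p \<noteq> 0\<close> power2_eq_square)
      qed
    qed
  qed
qed

section \<open>Patching by polynomial weights\<close>

text \<open>Approximating to within half the tolerance and then adding that half keeps the approximant
nonnegative.\<close>

lemma polynomial_approximation: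
  fixes \<psi> :: "real \<Rightarrow> real"
  assumes "compact K" "continuous_on K \<psi>" "e > 0" and nonneg: "\<And>x. x \<in> K \<Longrightarrow> \<psi> x \<ge> 0"
  obtains p where "\<And>x. x \<in> K \<Longrightarrow> poly p x \<ge> 0" "\<And>x. x \<in> K \<Longrightarrow> \<bar>\<psi> x - poly p x\<bar> \<le> e"
proof -
  obtain g where g: "real_polynomial_function g" "\<And>x. x \<in> K \<Longrightarrow> \<bar>\<psi> x - g x\<bar> < e / 2"
    using Stone_Weierstrass_real_polynomial_function[of K \<psi> "e / 2"] assms by auto
  obtain a n where a: "g = (\<lambda>x. \<Sum>i\<le>n. a i * x ^ i)"
    using g(1) real_polynomial_function_iff_sum by blast
  define p where "p = (\<Sum>i\<le>n. monom (a i) i) + [:e / 2:]"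
  have p: "poly p x = g x + e / 2" for x
    by (simp add: p_def a poly_sum poly_monom)
  show ?thesis
  proof
    show "poly p x \<ge> 0" "\<bar>\<psi> x - poly p x\<bar> \<le> e" if "x \<in> K" for x
      using g(2)[OF that] nonneg[OF that] unfolding p by linarith+
  qed
qed

text \<open>Near each point \<open>c\<close> the functions \<open>b c k\<close> are close to \<open>a k\<close>, by continuity. A continuous
partition of unity subordinate to a finite cover by such neighbourhoods combines them, and the
Weierstrass theorem replaces its members by nonnegative polynomials.\<close>

lemma polynomial_patching:
  fixes a :: "nat \<Rightarrow> real \<Rightarrow> real" and b :: "real \<Rightarrow> nat \<Rightarrow> real \<Rightarrow> real"
  assumes K: "compact K"
    and cont_a: "\<And>k. k \<le> N \<Longrightarrow> continuous_on K (a k)"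
    and cont_b: "\<And>c k. c \<in> K \<Longrightarrow> k \<le> N \<Longrightarrow> continuous_on K (b c k)"
    and agree: "\<And>c k. c \<in> K \<Longrightarrow> k \<le> N \<Longrightarrow> b c k c = a k c"
    and "e > 0"
  shows "\<exists>F p. finite F \<and> F \<subseteq> K \<and> (\<forall>c\<in>F. \<forall>x\<in>K. poly (p c) x \<ge> 0) \<and>
    (\<forall>k\<le>N. \<forall>x\<in>K. \<bar>a k x - (\<Sum>c\<in>F. poly (p c) x * b c k x)\<bar> \<le> e)"
proof -
  have "\<exists>d>0. \<forall>k\<le>N. \<forall>x\<in>K. dist x c < d \<longrightarrow> \<bar>a k x - b c k x\<bar> \<le> e / 2" if c: "c \<in> K" for c
  proof -
    have "\<exists>d>0. \<forall>x\<in>K. dist x c < d \<longrightarrow> \<bar>a k x - b c k x\<bar> \<le> e / 2" if k: "k \<le> N" for k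
    proof -
      have "continuous_on K (\<lambda>x. a k x - b c k x)"
        using cont_a cont_b c k by (intro continuous_intros) auto
      then obtain d where "d > 0"
        "\<forall>x\<in>K. dist x c < d \<longrightarrow> dist (a k x - b c k x) (a k c - b c k c) < e / 2"
        unfolding continuous_on_iff using c \<open>e > 0\<close> by (meson half_gt_zero)
      then show ?thesis
        using agree[OF c k] by (force simp: dist_real_def)
    qed
    then obtain d where d: "\<And>k. k \<le> N \<Longrightarrow> d k > 0"
      "\<And>k x. k \<le> N \<Longrightarrow> x \<in> K \<Longrightarrow> dist x c < d k \<Longrightarrow> \<bar>a k x - b c k x\<bar> \<le> e / 2"
      by metis
    show ?thesis
    proof (intro exI[of _ "Min (d ` {..N})"] conjI allI impI ballI)
      show "Min (d ` {..N}) > 0"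
        using d(1) by (subst Min_gr_iff) auto
      show "\<bar>a k x - b c k x\<bar> \<le> e / 2" if "k \<le> N" "x \<in> K" "dist x c < Min (d ` {..N})" for k x
        using that by (intro d(2)) auto
    qed
  qed
  then obtain d where d: "\<And>c. c \<in> K \<Longrightarrow> d c > 0"
    "\<And>c k x. c \<in> K \<Longrightarrow> k \<le> N \<Longrightarrow> x \<in> K \<Longrightarrow> dist x c < d c \<Longrightarrow> \<bar>a k x - b c k x\<bar> \<le> e / 2"
    by metis
  have "K \<subseteq> (\<Union>c\<in>K. ball c (d c))"
    using d(1) by auto
  then obtain F where F: "F \<subseteq> K" "finite F" "K \<subseteq> (\<Union>c\<in>F. ball c (d c))"
    using compactE_image[OF K, of K "\<lambda>c. ball c (d c)"] by (metis open_ball)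
  \<comment> \<open>The partition of unity consists of normalised tent functions.\<close>
  define u where "u c x = max 0 (d c - dist x c)" for c x
  define s where "s x = (\<Sum>c\<in>F. u c x)" for x
  define \<psi> where "\<psi> c x = u c x / s x" for c x
  have u_nonneg: "u c x \<ge> 0" for c x
    by (simp add: u_def)
  have s_pos: "s x > 0" if x: "x \<in> K" for x
  proof -
    obtain c where "c \<in> F" "x \<in> ball c (d c)"
      using F(3) x by blast
    then have "c \<in> F" "dist x c < d c"
      by (simp_all add: dist_commute)
    then have "u c x > 0"
      by (simp add: u_def)
    moreover have "u c x \<le> s x"
      unfolding s_def using \<open>c \<in> F\<close> F(2) u_nonneg by (intro member_le_sum) auto
    ultimately show ?thesis
      by simp
  qed
  have \<psi>_nonneg: "\<psi> c x \<ge> 0" if "x \<in> K" for c x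
    using u_nonneg s_pos[OF that] by (simp add: \<psi>_def)
  have \<psi>_sum: "(\<Sum>c\<in>F. \<psi> c x) = 1" if "x \<in> K" for x
    using s_pos[OF that] by (simp add: \<psi>_def s_def flip: sum_divide_distrib)
  have \<psi>_cont: "continuous_on K (\<psi> c)" for c
  proof -
    have "s x \<noteq> 0" if "x \<in> K" for x
      using s_pos[OF that] by simp
    then show ?thesis
      unfolding \<psi>_def by (auto simp: s_def u_def intro!: continuous_intros)
  qed
  have "\<exists>M. \<forall>x\<in>K. \<bar>b c k x\<bar> \<le> M" if "c \<in> F" "k \<le> N" for c k
  proof -
    have "compact (b c k ` K)"
      using cont_b that F(1) K by (intro compact_continuous_image) auto
    then show ?thesis
      by (metis bounded_iff compact_imp_bounded imageI real_norm_def)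
  qed
  then obtain M where M: "\<And>c k x. c \<in> F \<Longrightarrow> k \<le> N \<Longrightarrow> x \<in> K \<Longrightarrow> \<bar>b c k x\<bar> \<le> M c k"
    by metis
  define B where "B = (\<Sum>c\<in>F. \<Sum>k\<le>N. \<bar>M c k\<bar>) + 1"
  have "B > 0"
    unfolding B_def by (intro add_nonneg_pos sum_nonneg) auto
  have B: "\<bar>b c k x\<bar> \<le> B" if "c \<in> F" "k \<le> N" "x \<in> K" for c k x
  proof -
    have "\<bar>M c k\<bar> \<le> (\<Sum>k\<le>N. \<bar>M c k\<bar>)"
      using that by (intro member_le_sum) auto
    also have "\<dots> \<le> (\<Sum>c\<in>F. \<Sum>k\<le>N. \<bar>M c k\<bar>)"
      using that F(2) by (intro member_le_sum[of c F "\<lambda>c. \<Sum>k\<le>N. \<bar>M c k\<bar>"] sum_nonneg) auto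
    finally show ?thesis
      using M[OF that] by (simp add: B_def)
  qed
  \<comment> \<open>The Weierstrass error is chosen after the finite cover, since it is multiplied by the number of its members and by the size of the local data.\<close>
  define m where "m = real (card F) + 1"
  have "m > 0"
    by (simp add: m_def)
  define \<eta> where "\<eta> = e / 2 / m / B"
  have "\<eta> > 0"
    using \<open>e > 0\<close> \<open>B > 0\<close> \<open>m > 0\<close> by (simp add: \<eta>_def)
  have "\<exists>p. (\<forall>x\<in>K. poly p x \<ge> 0) \<and> (\<forall>x\<in>K. \<bar>\<psi> c x - poly p x\<bar> \<le> \<eta>)" for c
    using polynomial_approximation[OF K \<psi>_cont \<open>\<eta> > 0\<close> \<psi>_nonneg] by metis
  then obtain p where p: "\<And>c x. x \<in> K \<Longrightarrow> poly (p c) x \<ge> 0"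
    "\<And>c x. x \<in> K \<Longrightarrow> \<bar>\<psi> c x - poly (p c) x\<bar> \<le> \<eta>"
    by metis
  show ?thesis
  proof (intro exI[of _ F] exI[of _ p] conjI ballI allI impI)
    fix k x assume k: "k \<le> N" and x: "x \<in> K"
    have "a k x - (\<Sum>c\<in>F. poly (p c) x * b c k x) =
        (\<Sum>c\<in>F. \<psi> c x * a k x) - (\<Sum>c\<in>F. poly (p c) x * b c k x)"
      using \<psi>_sum[OF x] by (simp flip: sum_distrib_right)
    also have "\<dots> = (\<Sum>c\<in>F. \<psi> c x * (a k x - b c k x) + (\<psi> c x - poly (p c) x) * b c k x)"
      unfolding sum_subtractf[symmetric] by (intro sum.cong) (simp_all add: algebra_simps)
    also have "\<bar>\<dots>\<bar> \<le> (\<Sum>c\<in>F. \<psi> c x * (e / 2) + \<eta> * B)"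
    proof (rule order_trans[OF sum_abs], rule sum_mono)
      fix c assume c: "c \<in> F"
      have "\<bar>\<psi> c x * (a k x - b c k x)\<bar> \<le> \<psi> c x * (e / 2)"
      proof (cases "dist x c < d c")
        case True
        then have "\<bar>a k x - b c k x\<bar> \<le> e / 2"
          using d(2) c k x F(1) by blast
        then have "\<psi> c x * \<bar>a k x - b c k x\<bar> \<le> \<psi> c x * (e / 2)"
          by (rule mult_left_mono[OF _ \<psi>_nonneg[OF x]])
        then show ?thesis
          using \<psi>_nonneg[OF x, of c] by (simp only: abs_mult abs_of_nonneg)
      next
        case False
        then show ?thesis
          by (simp add: \<psi>_def u_def)
      qed
      moreover have "\<bar>(\<psi> c x - poly (p c) x) * b c k x\<bar> \<le> \<eta> * B"
        using p(2)[OF x] B[OF c k x] \<open>\<eta> > 0\<close> unfolding abs_mult by (intro mult_mono) auto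
      ultimately show
        "\<bar>\<psi> c x * (a k x - b c k x) + (\<psi> c x - poly (p c) x) * b c k x\<bar> \<le> \<psi> c x * (e / 2) + \<eta> * B"
        by linarith
    qed
    also have "\<dots> = e / 2 + card F * (\<eta> * B)"
      using \<psi>_sum[OF x] by (simp add: sum.distrib flip: sum_divide_distrib sum_distrib_right)
    also have "\<dots> \<le> e / 2 + m * (\<eta> * B)"
      using \<open>\<eta> > 0\<close> \<open>B > 0\<close> by (intro add_left_mono mult_right_mono) (auto simp: m_def)
    also have "m * (\<eta> * B) = e / 2"
      using \<open>B > 0\<close> \<open>m > 0\<close> by (simp add: \<eta>_def)
    also have "e / 2 + e / 2 = e"
      by simp
    finally show "\<bar>a k x - (\<Sum>c\<in>F. poly (p c) x * b c k x)\<bar> \<le> e" .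
  qed (use F p(1) in auto)
qed

section \<open>Preorderings and their double duals\<close>

lemma sos_zero: "0 \<in> sos"
  unfolding sos_def by (rule CollectI, rule exI[of _ "[]"]) simp

lemma sos_square: "h\<^sup>2 \<in> sos"
  unfolding sos_def by (rule CollectI, rule exI[of _ "[h]"]) simp

lemma sos_add:
  assumes "f \<in> sos" "g \<in> sos"
  shows "f + g \<in> sos"
proof -
  obtain ps qs where "f = (\<Sum>q\<leftarrow>ps. q\<^sup>2)" "g = (\<Sum>q\<leftarrow>qs. q\<^sup>2)"
    using assms by (auto simp: sos_def)
  then have "f + g = (\<Sum>q\<leftarrow>ps @ qs. q\<^sup>2)"
    by simp
  then show ?thesis
    unfolding sos_def by blast
qed

lemma sos_square_mult:
  assumes "f \<in> sos"
  shows "h\<^sup>2 * f \<in> sos"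
proof -
  obtain qs where "f = (\<Sum>q\<leftarrow>qs. q\<^sup>2)"
    using assms by (auto simp: sos_def)
  then have "h\<^sup>2 * f = (\<Sum>q\<leftarrow>map ((*) h) qs. q\<^sup>2)"
    by (simp add: power_mult_distrib comp_def flip: sum_list_const_mult)
  then show ?thesis
    unfolding sos_def by blast
qed

lemma sos_mult:
  assumes "f \<in> sos" "g \<in> sos"
  shows "f * g \<in> sos"
proof -
  obtain qs where f: "f = (\<Sum>q\<leftarrow>qs. q\<^sup>2)"
    using assms(1) by (auto simp: sos_def)
  show ?thesis
    unfolding f
    by (induction qs) (auto simp: sos_zero distrib_right intro!: sos_add sos_square_mult[OF assms(2)])
qed

lemma eval2_sos_nonneg:
  assumes "f \<in> sos"
  shows "eval2 f z \<ge> 0"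
proof -
  obtain qs where f: "f = (\<Sum>q\<leftarrow>qs. q\<^sup>2)"
    using assms by (auto simp: sos_def)
  show ?thesis
    unfolding f by (induction qs) auto
qed

abbreviation generator_product :: "rpoly2 list \<Rightarrow> (nat \<Rightarrow> nat) \<Rightarrow> rpoly2" where
  "generator_product fs e \<equiv> (\<Prod>i<length fs. (fs ! i) ^ e i)"

lemma finite_exponents: "finite ({..<length fs} \<rightarrow>\<^sub>E {0, 1::nat})"
  by (intro finite_PiE) auto

lemma preordering_add:
  assumes "f \<in> preordering fs" "g \<in> preordering fs"
  shows "f + g \<in> preordering fs"
proof -
  let ?E = "{..<length fs} \<rightarrow>\<^sub>E {0, 1::nat}"
  obtain \<sigma> \<tau> where f: "f = (\<Sum>e\<in>?E. \<sigma> e * generator_product fs e)" "\<forall>e\<in>?E. \<sigma> e \<in> sos"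
    and g: "g = (\<Sum>e\<in>?E. \<tau> e * generator_product fs e)" "\<forall>e\<in>?E. \<tau> e \<in> sos"
    using assms unfolding preordering_def by blast
  have "f + g = (\<Sum>e\<in>?E. (\<sigma> e + \<tau> e) * generator_product fs e)"
    by (simp add: f g distrib_right sum.distrib)
  moreover have "\<forall>e\<in>?E. \<sigma> e + \<tau> e \<in> sos"
    using f g sos_add by blast
  ultimately show ?thesis
    unfolding preordering_def mem_Collect_eq by (intro exI[of _ "\<lambda>e. \<sigma> e + \<tau> e"]) auto
qed

lemma preordering_term:
  assumes "s \<in> sos" "e \<in> {..<length fs} \<rightarrow>\<^sub>E {0, 1::nat}"
  shows "s * generator_product fs e \<in> preordering fs"
proof -
  let ?E = "{..<length fs} \<rightarrow>\<^sub>E {0, 1::nat}"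
  have "(\<Sum>e'\<in>?E. (if e' = e then s else 0) * generator_product fs e') =
      (\<Sum>e'\<in>?E. if e' = e then s * generator_product fs e else 0)"
    by (intro sum.cong) auto
  also have "\<dots> = s * generator_product fs e"
    using assms(2) finite_exponents by (subst sum.delta) auto
  finally show ?thesis
    using assms sos_zero unfolding preordering_def mem_Collect_eq
    by (intro exI[of _ "\<lambda>e'. if e' = e then s else 0"]) auto
qed

lemma preordering_induct [consumes 1, case_names zero add]:
  assumes "f \<in> preordering fs"
    and "P 0"
    and "\<And>s e g. s \<in> sos \<Longrightarrow> e \<in> {..<length fs} \<rightarrow>\<^sub>E {0, 1::nat} \<Longrightarrow> P g \<Longrightarrow>
      P (s * generator_product fs e + g)"
  shows "P f"
proof -
  let ?E = "{..<length fs} \<rightarrow>\<^sub>E {0, 1::nat}"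
  obtain \<sigma> where f: "f = (\<Sum>e\<in>?E. \<sigma> e * generator_product fs e)" "\<forall>e\<in>?E. \<sigma> e \<in> sos"
    using assms(1) unfolding preordering_def by blast
  have "P (\<Sum>e\<in>A. \<sigma> e * generator_product fs e)" if "A \<subseteq> ?E" for A
    using finite_subset[OF that finite_exponents] that
  proof (induction A rule: finite_induct)
    case (insert e A)
    then show ?case
      using assms(3)[of "\<sigma> e" e] f(2) by simp
  qed (simp add: assms(2))
  then show ?thesis
    using f(1) by simp
qed

lemma sos_subset_preordering: "s \<in> sos \<Longrightarrow> s \<in> preordering fs"
  using preordering_term[of s "\<lambda>i. if i < length fs then 0 else undefined" fs]
  by (simp add: PiE_def extensional_def)

lemma preordering_sos_mult:
  assumes "s \<in> sos" "f \<in> preordering fs"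
  shows "s * f \<in> preordering fs"
  using assms(2)
proof (induction rule: preordering_induct)
  case zero
  then show ?case
    by (simp add: sos_subset_preordering sos_zero)
next
  case (add t e g)
  then have "(s * t) * generator_product fs e + s * g \<in> preordering fs"
    by (intro preordering_add preordering_term sos_mult assms(1))
  then show ?case
    by (simp add: algebra_simps)
qed

text \<open>If the generator already occurs in a term, its square is absorbed by the sum of squares in front.\<close>

lemma preordering_generator_mult:
  assumes i: "i < length fs" and "f \<in> preordering fs"
  shows "fs ! i * f \<in> preordering fs"
  using assms(2)
proof (induction rule: preordering_induct)
  case zero
  then show ?case
    by (simp add: sos_subset_preordering sos_zero)
next
  case (add s e g)
  define rest where "rest = (\<Prod>j\<in>{..<length fs} - {i}. (fs ! j) ^ e j)"
  have split: "generator_product fs (e(i := k)) = (fs ! i) ^ k * rest" for k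
    using i by (subst prod.remove[of _ i]) (auto simp: rest_def intro!: prod.cong)
  have upd: "e(i := k) \<in> {..<length fs} \<rightarrow>\<^sub>E {0, 1::nat}" if "k \<in> {0, 1}" for k
    using add.hyps(2) i that by (auto simp: PiE_iff extensional_def)
  have e: "generator_product fs e = (fs ! i) ^ e i * rest"
    using split[of "e i"] by simp
  have "e i = 0 \<or> e i = 1"
    using add.hyps(2) i by (auto simp: PiE_iff)
  then have "fs ! i * (s * generator_product fs e) \<in> preordering fs"
  proof
    assume "e i = 0"
    then have "fs ! i * (s * generator_product fs e) = s * generator_product fs (e(i := 1))"
      by (simp only: e split) simp
    then show ?thesis
      by (simp only:) (intro preordering_term add.hyps(1) upd, simp)
  next
    assume "e i = 1"
    then have "fs ! i * (s * generator_product fs e) = ((fs ! i)\<^sup>2 * s) * generator_product fs (e(i := 0))"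
      by (simp only: e split) (simp add: power2_eq_square)
    then show ?thesis
      by (simp only:) (intro preordering_term sos_square_mult add.hyps(1) upd, simp)
  qed
  then show ?case
    using preordering_add[OF _ add.IH] by (simp add: distrib_left)
qed

lemma preordering_mult:
  assumes "f \<in> preordering fs" "g \<in> preordering fs"
  shows "f * g \<in> preordering fs"
  using assms(1)
proof (induction rule: preordering_induct)
  case zero
  then show ?case
    by (simp add: sos_subset_preordering sos_zero)
next
  case (add s e h)
  have pow: "(fs ! i) ^ k * p \<in> preordering fs" if "i < length fs" "p \<in> preordering fs" for i k p
    using that by (induction k) (auto simp: mult.assoc intro: preordering_generator_mult)
  have "(\<Prod>i\<in>A. (fs ! i) ^ e i) * g \<in> preordering fs" if "A \<subseteq> {..<length fs}" for A
    using finite_subset[OF that finite_lessThan] that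
    by (induction A rule: finite_induct) (use assms(2) pow in \<open>auto simp: mult.assoc\<close>)
  from this[of "{..<length fs}"] have "s * (generator_product fs e * g) + h * g \<in> preordering fs"
    by (intro preordering_add[OF preordering_sos_mult[OF add.hyps(1)] add.IH]) simp
  then show ?case
    by (simp add: algebra_simps)
qed

lemma generator_mem_preordering:
  assumes "f \<in> set fs"
  shows "f \<in> preordering fs"
proof -
  obtain i where "i < length fs" "f = fs ! i"
    using assms by (metis in_set_conv_nth)
  then show ?thesis
    using preordering_generator_mult[of i fs 1] sos_subset_preordering sos_square[of 1] by simp
qed

lemma preordering_nonneg:
  assumes "f \<in> preordering fs" "z \<in> semialg_set fs"
  shows "eval2 f z \<ge> 0"
  using assms(1)
proof (induction rule: preordering_induct)
  case (add s e g)
  have "eval2 (\<Prod>i\<in>A. (fs ! i) ^ e i) z \<ge> 0" if "A \<subseteq> {..<length fs}" for A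
    using finite_subset[OF that finite_lessThan] that
    by (induction A rule: finite_induct) (use assms(2) in \<open>auto simp: semialg_set_def\<close>)
  then show ?case
    using add eval2_sos_nonneg by simp
qed simp

lemma double_dualD:
  assumes "f \<in> double_dual P" "linear_functional L" "\<And>p. p \<in> P \<Longrightarrow> L p \<ge> 0"
  shows "L f \<ge> 0"
  using assms by (auto simp: double_dual_def)

lemma double_dual_subset: "P \<subseteq> double_dual P"
  by (auto simp: double_dual_def)

lemma linear_functional_mult:
  assumes "linear_functional L"
  shows "linear_functional (\<lambda>g. L (f * g))"
  using assms by (simp add: linear_functional_iff distrib_left scale2_def)

text \<open>If \<open>L\<close> is nonnegative on \<open>P\<close>, so is \<open>L (p * _)\<close> for \<open>p \<in> P\<close>; hence \<open>L (p * g) \<ge> 0\<close>. Thus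
\<open>L (_ * g)\<close> is nonnegative on \<open>P\<close> as well, and may be applied to \<open>f\<close>.\<close>

lemma double_dual_mult:
  assumes P: "\<And>p q. p \<in> P \<Longrightarrow> q \<in> P \<Longrightarrow> p * q \<in> P"
    and f: "f \<in> double_dual P" and g: "g \<in> double_dual P"
  shows "f * g \<in> double_dual P"
  unfolding double_dual_def
proof (intro CollectI allI impI)
  fix L assume L: "linear_functional L \<and> L ` P \<subseteq> {0..}"
  have 1: "L (p * g) \<ge> 0" if p: "p \<in> P" for p
    by (rule double_dualD[OF g linear_functional_mult[of L p]]) (use L P[OF p] in auto)
  have "L (g * f) \<ge> 0"
    by (rule double_dualD[OF f linear_functional_mult[of L g]]) (use L 1 in \<open>auto simp: mult.commute\<close>)
  then show "L (f * g) \<ge> 0"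
    by (simp add: mult.commute)
qed

text \<open>\<open>L f + e * L q \<ge> 0\<close> for every \<open>e > 0\<close> forces \<open>L f \<ge> 0\<close>. The correction \<open>q\<close> must be
independent of \<open>e\<close>.\<close>

lemma double_dual_limit:
  assumes "\<And>e. e > 0 \<Longrightarrow> f + scale2 e q \<in> double_dual P"
  shows "f \<in> double_dual P"
  unfolding double_dual_def
proof (intro CollectI allI impI)
  fix L assume L: "linear_functional L \<and> L ` P \<subseteq> {0..}"
  have lim: "L f + e * L q \<ge> 0" if "e > 0" for e
  proof -
    have "L (f + scale2 e q) \<ge> 0"
      by (rule double_dualD[OF assms[OF that], of L]) (use L in auto)
    then show ?thesis
      using L by (simp add: linear_functional_iff)
  qed
  show "L f \<ge> 0"
  proof (rule field_le_epsilon)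
    fix d :: real assume "d > 0"
    have "d / (\<bar>L q\<bar> + 1) * L q \<le> d"
      using mult_left_mono[of "L q" "\<bar>L q\<bar> + 1" d] \<open>d > 0\<close> by (simp add: pos_divide_le_eq)
    then show "0 \<le> L f + d"
      using lim[of "d / (\<bar>L q\<bar> + 1)"] \<open>d > 0\<close> by simp
  qed
qed

lemma double_dual_add: "f \<in> double_dual P \<Longrightarrow> g \<in> double_dual P \<Longrightarrow> f + g \<in> double_dual P"
  by (simp add: double_dual_def linear_functional_iff)

lemma linear_functional_eval2: "linear_functional (\<lambda>f. eval2 f z)"
  by (simp add: linear_functional_iff)

lemma double_dual_preordering_subset_Pos: "double_dual (preordering fs) \<subseteq> Pos (semialg_set fs)"
proof
  fix f assume f: "f \<in> double_dual (preordering fs)"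
  have "eval2 f z \<ge> 0" if "z \<in> semialg_set fs" for z
    by (rule double_dualD[OF f linear_functional_eval2]) (rule preordering_nonneg[OF _ that])
  then show "f \<in> Pos (semialg_set fs)"
    by (simp add: Pos_def)
qed

section \<open>Membership by fibres over the base interval\<close>

lemma poly_fibre: "poly (map_poly (\<lambda>c. poly c x) f) y = eval2 f (x, y)"
  by (induction f) (simp_all add: map_poly_pCons eval2_def algebra_simps)

lemma degree_fibre_le: "degree (map_poly (\<lambda>c. poly c x) f) \<le> degree f"
  by (rule degree_le) (simp add: coeff_map_poly coeff_eq_0)

lemma coeff_eq_on_fibre:
  assumes "\<And>y. eval2 f (x, y) = eval2 g (x, y)"
  shows "poly (coeff f k) x = poly (coeff g k) x"
proof -
  have "map_poly (\<lambda>c. poly c x) f = map_poly (\<lambda>c. poly c x) g"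
    by (rule poly_ext) (simp add: poly_fibre assms)
  then have "coeff (map_poly (\<lambda>c. poly c x) f) k = coeff (map_poly (\<lambda>c. poly c x) g) k"
    by simp
  then show ?thesis
    by (simp add: coeff_map_poly)
qed

lemma eval2_const: "eval2 [:a:] (x, y) = poly a x"
  by (simp add: eval2_def)

lemma eval2_coefficient_embedding: "eval2 (map_poly (\<lambda>c. [:c:]) p) (x, y) = poly p y"
  by (induction p) (simp_all add: map_poly_pCons eval2_def algebra_simps)

lemma scale2_conv_mult: "scale2 c f = [:[:c:]:] * f"
  by (simp add: scale2_def)

lemma var_Y_plus_var_X_eq: "var_Y + var_X = [:[:0, 1:], 1:]"
  by (simp add: var_X_def var_Y_def)

lemma one_minus_var_X_var_Y_eq: "1 - var_X * var_Y = [:1, [:0, -1:]:]"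
  by (simp add: var_X_def var_Y_def one_pCons)

text \<open>The double dual of a preordering is the motivating instance. Only the closure properties below enter
the approximation arguments, so the functionals can be forgotten from here on.\<close>

locale closed_preordering =
  fixes Q :: "rpoly2 set"
  assumes add: "f \<in> Q \<Longrightarrow> g \<in> Q \<Longrightarrow> f + g \<in> Q"
    and mult: "f \<in> Q \<Longrightarrow> g \<in> Q \<Longrightarrow> f * g \<in> Q"
    and square: "f\<^sup>2 \<in> Q"
    and limit: "(\<And>e. e > 0 \<Longrightarrow> f + scale2 e q \<in> Q) \<Longrightarrow> f \<in> Q"
begin

lemma const: "c \<ge> 0 \<Longrightarrow> [:[:c:]:] \<in> Q"
  using square[of "[:[:sqrt c:]:]"] by (simp add: power2_eq_square)

lemma sum_mem: "(\<And>i. i \<in> A \<Longrightarrow> f i \<in> Q) \<Longrightarrow> sum f A \<in> Q"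
  by (induction A rule: infinite_finite_induct) (use const[of 0] add in auto)

text \<open>The grading by degree in \<open>Y\<close> makes this family a candidate for \<open>interval_certificate\<close>: a polynomial on
the fibre over \<open>x\<close> belongs to it if it extends to a member of \<open>Q\<close> on the whole plane.\<close>

definition lifts :: "real \<Rightarrow> nat \<Rightarrow> real poly set" where
  "lifts x n = {p. \<exists>g\<in>Q. degree g \<le> n \<and> (\<forall>y. eval2 g (x, y) = poly p y)}"

lemma liftsI: "g \<in> Q \<Longrightarrow> degree g \<le> n \<Longrightarrow> (\<And>y. eval2 g (x, y) = poly p y) \<Longrightarrow> p \<in> lifts x n"
  by (auto simp: lifts_def)

text \<open>On the fibre over \<open>x\<close> it suffices to lift the linear forms that are positive on \<open>I\<close>. Constants and
squares lift trivially, and products lift because \<open>Q\<close> is closed under multiplication.\<close>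

lemma fibre_certificate:
  assumes lower: "\<And>c. (\<And>y. y \<in> I \<Longrightarrow> c < y) \<Longrightarrow> [:-c, 1:] \<in> lifts x 1"
    and upper: "\<And>c. (\<And>y. y \<in> I \<Longrightarrow> y < c) \<Longrightarrow> [:c, -1:] \<in> lifts x 1"
    and I: "open I" "connected I" "I \<noteq> {}"
    and nonneg: "\<And>y. y \<in> I \<Longrightarrow> poly p y \<ge> 0"
  shows "p \<in> lifts x (degree p)"
proof (rule interval_certificate[where Q = "lifts x", OF _ _ lower upper _ I nonneg])
  show "[:c:] \<in> lifts x 0" if "c \<ge> 0" for c
    using const[OF that] by (rule liftsI) (simp_all add: eval2_def)
  show "[:- a, 1:]\<^sup>2 + [:b\<^sup>2:] \<in> lifts x 2" for a b
  proof (rule liftsI)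
    show "[:[:-a:], 1:]\<^sup>2 + [:[:b:]:]\<^sup>2 \<in> Q"
      by (intro add square)
  qed (simp_all add: eval2_def power2_eq_square algebra_simps)
  show "p * q \<in> lifts x (m + n)" if pq: "p \<in> lifts x m" "q \<in> lifts x n" for p q m n
  proof -
    obtain f g where "f \<in> Q" "degree f \<le> m" "\<And>y. eval2 f (x, y) = poly p y"
      "g \<in> Q" "degree g \<le> n" "\<And>y. eval2 g (x, y) = poly q y"
      using pq by (auto simp: lifts_def)
    then show ?thesis
      by (intro liftsI[of "f * g"] mult order_trans[OF degree_mult_le]) auto
  qed
qed auto

end

locale strip_preordering = closed_preordering +
  assumes strip: "1 - var_X\<^sup>2 \<in> Q"
begin

text \<open>The linear forms \<open>1 + s * X\<close> with \<open>s = 1\<close> or \<open>s = -1\<close> are combinations of squares and \<open>1 - X\<^sup>2\<close>,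
and they generate all polynomials in \<open>X\<close> nonnegative on the base interval.\<close>

lemma coefficient_mem:
  assumes "\<And>x. x \<in> {-1..1} \<Longrightarrow> poly a x \<ge> 0"
  shows "[:a:] \<in> Q"
proof -
  have half: "[:[:1, s:]:] \<in> Q" if "s\<^sup>2 = 1" for s :: real
  proof -
    have "[:[:1, s:]:] = [:[:1/2:]:] * ([:[:1, s:]:]\<^sup>2 + (1 - var_X\<^sup>2))"
      using that by (simp add: var_X_def power2_eq_square one_pCons)
    moreover have "[:[:1/2:]:] * ([:[:1, s:]:]\<^sup>2 + (1 - var_X\<^sup>2)) \<in> Q"
      by (intro mult const add square strip) simp
    ultimately show ?thesis
      by (simp only:)
  qed
  have "a \<in> {p. [:p:] \<in> Q}"
  proof (rule interval_certificate[where I = "{-1<..<1}" and Q = "\<lambda>_. {p. [:p:] \<in> Q}"])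
    show "[:- b, 1:]\<^sup>2 + [:c\<^sup>2:] \<in> {p. [:p:] \<in> Q}" for b c
      using add[OF square[of "[:[:-b, 1:]:]"] square[of "[:[:c:]:]"]]
      by (simp add: power2_eq_square)
    show "[:- c, 1:] \<in> {p. [:p:] \<in> Q}" if "\<And>y. y \<in> {-1<..<1} \<Longrightarrow> c < y" for c
    proof -
      have "c \<le> -1"
        using that by (intro dense_ge_bounded[of "-1" 1]) (auto intro: less_imp_le)
      then have "[:[:1, 1:]:] + [:[:-1 - c:]:] \<in> Q"
        by (intro add half const) auto
      then show ?thesis
        by simp
    qed
    show "[:c, - 1:] \<in> {p. [:p:] \<in> Q}" if "\<And>y. y \<in> {-1<..<1} \<Longrightarrow> y < c" for c
    proof -
      have "1 \<le> c"
        using that by (intro dense_le_bounded[of "-1" 1]) (auto intro: less_imp_le)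
      then have "[:[:1, -1:]:] + [:[:c - 1:]:] \<in> Q"
        by (intro add half const) auto
      then show ?thesis
        by simp
    qed
    show "p * q \<in> {p. [:p:] \<in> Q}" if "p \<in> {p. [:p:] \<in> Q}" "q \<in> {p. [:p:] \<in> Q}" for p q
      using mult[of "[:p:]" "[:q:]"] that by (simp add: mult.commute)
  qed (use assms const in auto)
  then show ?thesis
    by simp
qed

text \<open>With \<open>T = Y ^ k\<close> and a coefficient \<open>a\<close> bounded by \<open>2 * e\<close>, the identity
\<open>4 * (a * T + e * (1 + T\<^sup>2)) = (2 * e + a) * (1 + T)\<^sup>2 + (2 * e - a) * (1 - T)\<^sup>2\<close>
writes each monomial, up to a small multiple of \<open>1 + T\<^sup>2\<close>, with coefficients that are nonnegative on the
base interval.\<close>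

lemma small_coefficients:
  assumes deg: "degree r \<le> N"
    and small: "\<And>k x. k \<le> N \<Longrightarrow> x \<in> {-1..1} \<Longrightarrow> \<bar>poly (coeff r k) x\<bar> \<le> 2 * e"
  shows "r + scale2 e (\<Sum>k\<le>N. 1 + (var_Y ^ k)\<^sup>2) \<in> Q"
proof -
  define H :: rpoly2 where "H = [:[:1/4:]:]"
  define E :: rpoly2 where "E = [:[:e:]:]"
  have H: "4 * H = 1"
    by (simp add: H_def one_pCons numeral_poly)
  have "[:coeff r k:] * var_Y ^ k + E * (1 + (var_Y ^ k)\<^sup>2) \<in> Q" if k: "k \<le> N" for k
  proof -
    have "[:[:2 * e:] + coeff r k:] \<in> Q" "[:[:2 * e:] - coeff r k:] \<in> Q"
      using small[OF k] by (fastforce intro!: coefficient_mem simp: abs_le_iff)+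
    moreover have "[:[:2 * e:] + coeff r k:] = 2 * E + [:coeff r k:]"
      "[:[:2 * e:] - coeff r k:] = 2 * E - [:coeff r k:]"
      by (simp_all add: E_def numeral_poly)
    ultimately have "2 * E + [:coeff r k:] \<in> Q" "2 * E - [:coeff r k:] \<in> Q"
      by (simp_all only:)
    then have "H * ((2 * E + [:coeff r k:]) * (1 + var_Y ^ k)\<^sup>2 +
        (2 * E - [:coeff r k:]) * (1 - var_Y ^ k)\<^sup>2) \<in> Q"
      unfolding H_def by (intro mult[OF const] add[OF mult[OF _ square] mult[OF _ square]]) auto
    moreover have "H * ((2 * E + A) * (1 + T)\<^sup>2 + (2 * E - A) * (1 - T)\<^sup>2) =
        (4 * H) * (A * T + E * (1 + T\<^sup>2))" for A T :: rpoly2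
      by (simp add: power2_eq_square algebra_simps)
    ultimately show ?thesis
      by (simp add: H)
  qed
  then have "(\<Sum>k\<le>N. [:coeff r k:] * var_Y ^ k + E * (1 + (var_Y ^ k)\<^sup>2)) \<in> Q"
    by (intro sum_mem) auto
  moreover have "(\<Sum>k\<le>N. [:coeff r k:] * var_Y ^ k) = r"
    using poly_as_sum_of_monoms'[OF deg] by (simp add: monom_altdef var_Y_def)
  ultimately have "r + (\<Sum>k\<le>N. E * (1 + (var_Y ^ k)\<^sup>2)) \<in> Q"
    by (subst (asm) sum.distrib) simp
  then show ?thesis
    by (simp only: scale2_conv_mult sum_distrib_left E_def)
qed

text \<open>The passage from fibres to the plane. Each lift \<open>g x\<close> agrees with \<open>f\<close> only over \<open>x\<close>, but its coefficients
are close to those of \<open>f\<close> near \<open>x\<close>. Patching the lifts with weights from \<open>Q\<close> leaves a remainder with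
small coefficients and degree at most \<open>N\<close>. Its correction term is a multiple of one polynomial depending
on \<open>N\<close> alone, so it disappears in the limit.\<close>

lemma fibrewise_mem:
  assumes deg: "degree f \<le> N"
    and fibre: "\<And>x. x \<in> {-1..1} \<Longrightarrow> map_poly (\<lambda>c. poly c x) f \<in> lifts x N"
  shows "f \<in> Q"
proof (rule limit)
  fix e :: real assume "e > 0"
  have "\<exists>g\<in>Q. degree g \<le> N \<and> (\<forall>k. poly (coeff g k) x = poly (coeff f k) x)"
    if "x \<in> {-1..1}" for x
    using fibre[OF that] coeff_eq_on_fibre unfolding lifts_def by (fastforce simp: poly_fibre)
  then obtain g where g: "\<And>x. x \<in> {-1..1} \<Longrightarrow> g x \<in> Q" "\<And>x. x \<in> {-1..1} \<Longrightarrow> degree (g x) \<le> N"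
    "\<And>x k. x \<in> {-1..1} \<Longrightarrow> poly (coeff (g x) k) x = poly (coeff f k) x"
    by metis
  have "\<exists>F p. finite F \<and> F \<subseteq> {-1..1} \<and> (\<forall>c\<in>F. \<forall>x\<in>{-1..1}. poly (p c) x \<ge> 0) \<and>
      (\<forall>k\<le>N. \<forall>x\<in>{-1..1}.
        \<bar>poly (coeff f k) x - (\<Sum>c\<in>F. poly (p c) x * poly (coeff (g c) k) x)\<bar> \<le> 2 * e)"
  proof (rule polynomial_patching)
    show "continuous_on {-1..1} (poly (coeff f k))" "continuous_on {-1..1} (poly (coeff (g c) k))"
      for c k
      by (intro continuous_intros)+
  qed (simp_all add: g(3) \<open>e > 0\<close>)
  then obtain F p where F: "finite F" "F \<subseteq> {-1..1}"
    "\<forall>c\<in>F. \<forall>x\<in>{-1..1}. poly (p c) x \<ge> 0"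
    "\<forall>k\<le>N. \<forall>x\<in>{-1..1}.
      \<bar>poly (coeff f k) x - (\<Sum>c\<in>F. poly (p c) x * poly (coeff (g c) k) x)\<bar> \<le> 2 * e"
    by blast
  define s where "s = (\<Sum>c\<in>F. [:p c:] * g c)"
  have "s \<in> Q"
    unfolding s_def using F(2,3) g(1) by (intro sum_mem mult coefficient_mem) auto
  moreover have "f - s + scale2 e (\<Sum>k\<le>N. 1 + (var_Y ^ k)\<^sup>2) \<in> Q"
  proof (rule small_coefficients)
    have "degree s \<le> N"
      unfolding s_def using F(2) g(2)
      by (intro degree_sum_le F(1)) (auto intro: order_trans[OF degree_smult_le])
    then show "degree (f - s) \<le> N"
      by (rule degree_diff_le[OF deg])
    show "\<bar>poly (coeff (f - s) k) x\<bar> \<le> 2 * e" if "k \<le> N" "x \<in> {-1..1}" for k x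
      using F(4) that by (simp add: s_def coeff_sum poly_sum)
  qed
  ultimately have "s + (f - s + scale2 e (\<Sum>k\<le>N. 1 + (var_Y ^ k)\<^sup>2)) \<in> Q"
    by (rule add)
  then show "f + scale2 e (\<Sum>k\<le>N. 1 + (var_Y ^ k)\<^sup>2) \<in> Q"
    by (simp add: algebra_simps)
qed

end

section \<open>The linear generator recovered from its cube\<close>

text \<open>The polynomial is \<open>k = (1 - (1 - e * y) ^ m) / y\<close> with odd \<open>m\<close>. For \<open>0 \<le> y < 1 / e\<close> the value \<open>y * k\<close> lies
between 0 and 1. For \<open>y < -e\<close> the power \<open>(1 - e * y) ^ m\<close> is at least 2 by Bernoulli's inequality once
\<open>m \<ge> 1 / e\<^sup>2\<close>, so that \<open>(y * k)\<^sup>2 \<ge> 1\<close>. Thus \<open>y\<^sup>3 * k\<^sup>2\<close>, a multiple of the cube by a square, stays below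
\<open>y + e\<close>.\<close>

lemma damping_polynomial:
  fixes e :: real
  assumes "e > 0"
  obtains k where "\<And>y. y < 1 / e \<Longrightarrow> y * (y * poly k y)\<^sup>2 \<le> y + e"
proof -
  obtain n :: nat where n: "1 / e\<^sup>2 \<le> n"
    using real_arch_simple by blast
  define u where "u = 1 - [:1, -e:] ^ (2 * n + 1)"
  have "poly u 0 = 0"
    by (simp add: u_def)
  then obtain k where k: "u = [:0, 1:] * k"
    using poly_eq_0_iff_dvd[of u 0] by (auto elim: dvdE)
  have u: "y * poly k y = 1 - (1 - e * y) ^ (2 * n + 1)" for y
    using arg_cong[OF k, of "\<lambda>p. poly p y"] by (simp add: u_def algebra_simps)
  show ?thesis
  proof
    fix y assume y: "y < 1 / e"
    then have ey: "e * y < 1"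
      using assms by (simp add: field_simps)
    define t where "t = (1 - e * y) ^ (2 * n + 1)"
    show "y * (y * poly k y)\<^sup>2 \<le> y + e"
    proof (cases "y \<ge> 0")
      case True
      then have "0 \<le> 1 - e * y" "1 - e * y \<le> 1"
        using ey assms by simp_all
      then have "0 \<le> t" "t \<le> 1"
        unfolding t_def by (simp_all only: zero_le_power power_le_one)
      then have "(1 - t)\<^sup>2 \<le> 1"
        by (simp add: power_le_one)
      then have "y * (1 - t)\<^sup>2 \<le> y * 1"
        using True by (rule mult_left_mono)
      then show ?thesis
        using assms by (simp add: u t_def)
    next
      case False
      show ?thesis
      proof (cases "y \<ge> - e")
        case True
        have "y * (y * poly k y)\<^sup>2 \<le> 0"
          using False by (simp add: mult_nonpos_nonneg)
        then show ?thesis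
          using True by linarith
      next
        case far: False
        have "1 \<le> n * e\<^sup>2"
          using n assms by (simp add: field_simps)
        also have "\<dots> \<le> (2 * n + 1) * (e * e)"
          unfolding power2_eq_square by (intro mult_right_mono) auto
        also have "\<dots> \<le> (2 * n + 1) * (e * - y)"
          using far assms by (intro mult_left_mono) auto
        finally have "2 \<le> 1 + real (2 * n + 1) * (- (e * y))"
          by simp
        also have "\<dots> \<le> (1 + - (e * y)) ^ (2 * n + 1)"
          using False assms by (intro Bernoulli_inequality) (auto simp: mult_le_0_iff intro: order_trans[of _ 0])
        finally have "t \<ge> 2"
          by (simp add: t_def)
        then have "1 \<le> (t - 1)\<^sup>2"
          by (intro one_le_power) simp
        then have "y * (t - 1)\<^sup>2 \<le> y * 1"
          using False by (intro mult_left_mono_neg) auto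
        then show ?thesis
          using assms by (simp add: u t_def power2_commute)
      qed
    qed
  qed
qed

text \<open>The generators enter through this locale. Since \<open>Y\<close> itself is not among them, showing that it belongs to
\<open>Q\<close> comes before the general case.\<close>

locale cubic_preordering = strip_preordering +
  assumes cube: "var_Y ^ 3 \<in> Q"
    and diagonal: "var_Y + var_X \<in> Q"
    and hyperbola: "1 - var_X * var_Y \<in> Q"
begin

lemma lifts_mono: "m \<le> n \<Longrightarrow> lifts x m \<subseteq> lifts x n"
  unfolding lifts_def by (blast intro: order_trans)

lemma diagonal_lift:
  assumes "c \<le> - x"
  shows "[:-c, 1:] \<in> lifts x 1"
proof (rule liftsI)
  show "var_Y + var_X + [:[:- x - c:]:] \<in> Q"
    using assms by (intro add diagonal const) simp
qed (simp_all add: var_Y_plus_var_X_eq eval2_def)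

lemma hyperbola_lift:
  assumes "x > 0" "c \<ge> 1 / x"
  shows "[:c, -1:] \<in> lifts x 1"
proof (rule liftsI)
  show "[:[:1 / x:]:] * (1 - var_X * var_Y) + [:[:c - 1 / x:]:] \<in> Q"
    using assms by (intro add mult const hyperbola) auto
  show "degree ([:[:1 / x:]:] * (1 - var_X * var_Y) + [:[:c - 1 / x:]:]) \<le> 1"
    by (simp add: one_minus_var_X_var_Y_eq)
  show "eval2 ([:[:1 / x:]:] * (1 - var_X * var_Y) + [:[:c - 1 / x:]:]) (x, y) = poly [:c, -1:] y" for y
    by (simp only: eval2_simps eval2_const) (use assms(1) in \<open>simp add: field_simps\<close>)
qed

text \<open>\<open>Y + e\<close> is lifted fibre by fibre. Over \<open>x \<le> e\<close> it is \<open>(Y + X) + (e - x)\<close>. Over \<open>x > e\<close> the damping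
polynomial splits off a square multiple of \<open>Y\<^sup>3\<close>; what remains is nonnegative for \<open>y < 1 / e\<close> and is certified
by \<open>1 - X * Y\<close>, because \<open>1 / x < 1 / e\<close>. The degree of the certificate grows as \<open>e\<close> tends to 0, so \<open>e\<close> is
fixed while patching; the limit of \<open>Y + e\<close> is taken afterwards.\<close>

lemma var_Y_mem: "var_Y \<in> Q"
proof (rule limit)
  fix e :: real assume "e > 0"
  obtain k where k: "\<And>y. y < 1 / e \<Longrightarrow> y * (y * poly k y)\<^sup>2 \<le> y + e"
    using damping_polynomial[OF \<open>e > 0\<close>] by blast
  define w where "w = [:e, 1:] - [:0, 1:] * ([:0, 1:] * k)\<^sup>2"
  define K where "K = map_poly (\<lambda>c. [:c:]) k"
  define N where "N = 1 + degree (var_Y ^ 3 * K\<^sup>2) + degree w"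
  let ?f = "var_Y + scale2 e 1"
  have f: "map_poly (\<lambda>c. poly c x) ?f = [:e, 1:]" for x
    by (simp add: var_Y_def scale2_def map_poly_pCons one_pCons)
  show "?f \<in> Q"
  proof (rule fibrewise_mem[of _ N])
    show "degree ?f \<le> N"
      by (simp add: N_def var_Y_def scale2_def one_pCons)
    fix x :: real assume "x \<in> {-1..1}"
    show "map_poly (\<lambda>c. poly c x) ?f \<in> lifts x N"
      unfolding f
    proof (cases "x \<le> e")
      case True
      then show "[:e, 1:] \<in> lifts x N"
        using diagonal_lift[of "- e" x] lifts_mono[of 1 N x] by (auto simp: N_def)
    next
      case False
      with \<open>e > 0\<close> have x: "x > 0" "1 / x < 1 / e"
        by (simp_all add: frac_less2)
      have "w \<in> lifts x (degree w)"
      proof (rule fibre_certificate[where I = "{..<1 / e}"])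
        show "[:- c, 1:] \<in> lifts x 1" if "\<And>y. y \<in> {..<1 / e} \<Longrightarrow> c < y" for c
        proof -
          have "c < min c (1 / e - 1)"
            by (rule that) (simp add: min_less_iff_disj)
          then show ?thesis
            by simp
        qed
        show "[:c, - 1:] \<in> lifts x 1" if "\<And>y. y \<in> {..<1 / e} \<Longrightarrow> y < c" for c
        proof -
          have "1 / e \<le> c"
            by (rule dense_le) (use that in \<open>auto intro: less_imp_le\<close>)
          then show ?thesis
            using hyperbola_lift[of x c] x by simp
        qed
        show "poly w y \<ge> 0" if "y \<in> {..<1 / e}" for y
          using k[of y] that by (simp add: w_def right_diff_distrib)
      qed auto
      then obtain g where g: "g \<in> Q" "degree g \<le> degree w" "\<And>y. eval2 g (x, y) = poly w y"
        by (auto simp: lifts_def)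
      show "[:e, 1:] \<in> lifts x N"
      proof (rule liftsI)
        show "var_Y ^ 3 * K\<^sup>2 + g \<in> Q"
          by (intro add mult cube square g)
        show "degree (var_Y ^ 3 * K\<^sup>2 + g) \<le> N"
          using g(2) by (intro degree_add_le) (auto simp: N_def)
        show "eval2 (var_Y ^ 3 * K\<^sup>2 + g) (x, y) = poly [:e, 1:] y" for y
          by (simp add: g K_def eval2_coefficient_embedding w_def)
            (simp add: power2_eq_square power3_eq_cube algebra_simps)
      qed
    qed
  qed
qed

lemma var_Y_lift:
  assumes "c \<le> 0"
  shows "[:-c, 1:] \<in> lifts x 1"
proof (rule liftsI)
  show "var_Y + [:[:- c:]:] \<in> Q"
    using assms by (intro add var_Y_mem const) simp
qed (simp_all add: var_Y_def eval2_def)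

section \<open>Polynomials nonnegative on the semialgebraic set\<close>

text \<open>The fibre over \<open>x > 0\<close> is the interval from 0 to \<open>1 / x\<close>, cut out by \<open>Y\<close> and \<open>1 - X * Y\<close>; the fibre over \<open>x \<le> 0\<close>
is the half-line above \<open>-x\<close>, cut out by \<open>Y + X\<close> alone. In both cases the linear forms positive on the
interior lift.\<close>

lemma nonneg_mem:
  assumes f: "\<And>x y. -1 \<le> x \<Longrightarrow> x \<le> 1 \<Longrightarrow> 0 \<le> y \<Longrightarrow> - x \<le> y \<Longrightarrow> x * y \<le> 1 \<Longrightarrow> eval2 f (x, y) \<ge> 0"
  shows "f \<in> Q"
proof (rule fibrewise_mem[of _ "degree f"])
  fix x :: real assume x: "x \<in> {-1..1}"
  let ?p = "map_poly (\<lambda>c. poly c x) f"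
  have "?p \<in> lifts x (degree ?p)"
  proof (cases "x > 0")
    case True
    show ?thesis
    proof (rule fibre_certificate[where I = "{0<..<1 / x}"])
      show "[:- c, 1:] \<in> lifts x 1" if "\<And>y. y \<in> {0<..<1 / x} \<Longrightarrow> c < y" for c
        using True that by (intro var_Y_lift dense_ge_bounded[of 0 "1 / x"]) (auto intro: less_imp_le)
      show "[:c, - 1:] \<in> lifts x 1" if "\<And>y. y \<in> {0<..<1 / x} \<Longrightarrow> y < c" for c
        using True that
        by (intro hyperbola_lift dense_le_bounded[of 0 "1 / x"]) (auto intro: less_imp_le)
      show "poly ?p y \<ge> 0" if "y \<in> {0<..<1 / x}" for y
      proof -
        have "x * y \<le> 1"
          using that True by (simp add: pos_less_divide_eq mult.commute)
        then show ?thesis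
          using that x True unfolding poly_fibre by (intro f) auto
      qed
    qed (use True in auto)
  next
    case False
    show ?thesis
    proof (rule fibre_certificate[where I = "{-x<..}"])
      show "[:- c, 1:] \<in> lifts x 1" if "\<And>y. y \<in> {-x<..} \<Longrightarrow> c < y" for c
        by (rule diagonal_lift, rule dense_ge) (use that in \<open>auto intro: less_imp_le\<close>)
      show "[:c, - 1:] \<in> lifts x 1" if "\<And>y. y \<in> {-x<..} \<Longrightarrow> y < c" for c
      proof -
        have "max c (1 - x) < c"
          by (rule that) (simp add: less_max_iff_disj)
        then show ?thesis
          by simp
      qed
      show "poly ?p y \<ge> 0" if "y \<in> {-x<..}" for y
      proof -
        have "x * y \<le> 0"
          using that False by (intro mult_nonpos_nonneg) auto
        then show ?thesis
          using that x False unfolding poly_fibre by (intro f) auto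
      qed
    qed auto
  qed
  then show "?p \<in> lifts x (degree f)"
    using lifts_mono[OF degree_fibre_le[of x f]] by auto
qed simp

end

theorem proposition3p1:
  shows "strong_moment_property [var_Y ^ 3, var_Y + var_X, 1 - var_X * var_Y, 1 - var_X ^ 2]"
proof -
  let ?fs = "[var_Y ^ 3, var_Y + var_X, 1 - var_X * var_Y, 1 - var_X ^ 2]"
  let ?Q = "double_dual (preordering ?fs)"
  have P: "p \<in> ?Q" if "p \<in> preordering ?fs" for p
    using that double_dual_subset by blast
  interpret cubic_preordering ?Q
  proof unfold_locales
    show "f\<^sup>2 \<in> ?Q" for f
      by (intro P sos_subset_preordering sos_square)
    show "1 - var_X\<^sup>2 \<in> ?Q" "var_Y ^ 3 \<in> ?Q" "var_Y + var_X \<in> ?Q" "1 - var_X * var_Y \<in> ?Q"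
      by (intro P generator_mem_preordering; simp)+
    show "f + g \<in> ?Q" "f * g \<in> ?Q" if "f \<in> ?Q" "g \<in> ?Q" for f g
      by (rule double_dual_add[OF that], rule double_dual_mult[OF preordering_mult that])
    show "f \<in> ?Q" if "\<And>e. e > 0 \<Longrightarrow> f + scale2 e q \<in> ?Q" for f q
      by (rule double_dual_limit) (rule that)
  qed
  have "Pos (semialg_set ?fs) \<subseteq> ?Q"
  proof
    fix f assume f: "f \<in> Pos (semialg_set ?fs)"
    show "f \<in> ?Q"
    proof (rule nonneg_mem)
      fix x y :: real
      assume "-1 \<le> x" "x \<le> 1" "0 \<le> y" "- x \<le> y" "x * y \<le> 1"
      then have "(x, y) \<in> semialg_set ?fs"
        by (simp add: semialg_set_def abs_square_le_1 abs_le_iff)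
      then show "eval2 f (x, y) \<ge> 0"
        using f by (simp add: Pos_def)
    qed
  qed
  then show ?thesis
    using double_dual_preordering_subset_Pos by (auto simp: strong_moment_property_def)
qed

end
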